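(* Let $\rho_\pm>0$ and $u_\pm\in\mathbb{R}$ with $u_->u_+$. Consider the Riemann problem $$\rho_t+(\rho u)_x=0,\qquad u_t+\left(\frac{u^2}{2}\right)_x=H(s(t)-x)$$ (that is, source terms $f\equiv 0$ on the right and $g\equiv 1$ on the left of the delta shock front $x=s(t)$), with initial data $(\rho,u)(x,0)=(\rho_-,u_-)$ for $x<0$ and $(\rho,u)(x,0)=(\rho_+,u_+)$ for $x>0$. Then the Riemann solution is a delta shock solution, which can be expressed as $$(\rho,u)(x,t)=\begin{cases}(\rho_-,\,u_-+t), & x<s(t),\\ (w(t),\,u_\delta(t)), & x=s(t),\\ (\rho_+,\,u_+), & x>s(t),\end{cases}$$ with $$s(t)=\tfrac12 t^2+\tfrac12(u_-+u_+)t,$$ $$w(t)=\tfrac12(\rho_-+\rho_+)\left\{\tfrac12 t^2+(u_--u_+)t\right\},$$ $$u_\delta(t)=\tfrac12(u_-+u_++t).$$ Furthermore, the delta shock exists for all time, taking into account the $\delta$-entropy condition.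
   Context: $H$ is the standard Heaviside function; $\rho>0$ is the density and $u$ the velocity. The general system is $$\rho_t+(\rho u)_x=0,\qquad u_t+\left(\tfrac{u^2}{2}\right)_x=H(x-s(t))f(x,t,u)+H(s(t)-x)g(x,t,u),$$ where the discontinuity of the source term is located at the (unknown) delta shock front $x=s(t)$, which is to be determined together with the solution. Delta shock solution. A delta shock solution of the Riemann problem on a time interval $[0,T)$, $0<T\le\infty$, consists of a front $x=s(t)$ with $s(0)=0$, a weight $w(t)$ with $w(0)=0$, a value $u_\delta(t)$ assigned to $u$ on the front, and functions $(\rho,u)$ that are smooth on each of the regions $x<s(t)$ and $x>s(t)$, such that: (1) in $x<s(t)$, $\rho_t+(\rho u)_x=0$ and $u_t+uu_x=g(x,t,u)$, with initial value $(\rho_-,u_-)$ for $x<0$; in $x>s(t)$, $\rho_t+(\rho u)_x=0$ and $u_t+uu_x=f(x,t,u)$, with initial value $(\rho_+,u_+)$ for $x>0$; (2) the generalized Rankine–Hugoniot conditions hold along $x=s(t)$: $$\frac{ds}{dt}=\sigma(t)=u_\delta(t),\qquad \frac{dw}{dt}=\sigma(t)[\rho]-[\rho u],\qquad \sigma(t)[u]=\left[\tfrac{u^2}{2}\right],$$ where $[h]=h(s(t)+0,t)-h(s(t)-0,t)$ denotes the jump across the front; (3) the $\delta$-entropy condition holds: $u(s(t)+0,t)<\dfrac{ds}{dt}<u(s(t)-0,t)$ for all $t\in[0,T)$. In the displayed form of the solution, the value $(w(t),u_\delta(t))$ on $x=s(t)$ means that $\rho$ carries a Dirac delta of weight $w(t)$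 on the front (in the sense that $w(0)=0$ and the generalized Rankine–Hugoniot conditions $\frac{ds}{dt}=\sigma(t)=u_\delta(t)$, $\frac{dw}{dt}=\sigma(t)[\rho]-[\rho u]$, $\sigma(t)[u]=\left[\tfrac{u^2}{2}\right]$ hold along $x=s(t)$) and that $u$ takes the value $u_\delta(t)$ there. The delta shock exists for all time if the displayed formulas define a delta shock solution on $[0,T)$ with $T=\infty$, i.e. if conditions (1), (2) and (3) hold for all $t\ge 0$.
   Formalization: The front is taken as s(t) = t²/4 + (u₋+u₊)t/2 instead of the printed t²/2 + (u₋+u₊)t/2, because the printed s has ds/dt = t + (u₋+u₊)/2, which differs from u_δ(t) = (u₋+u₊+t)/2 for every t > 0. *)

theory Defs
  imports "HOL-Analysis.Analysis"
begin

text \<open>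
  The time interval \<open>[0,T)\<close> with \<open>0 < T \<le> \<infinity>\<close>.
\<close>

definition time_interval :: "ereal \<Rightarrow> real set" where
  "time_interval T = {t. 0 \<le> t \<and> ereal t < T}"

text \<open>
  The regions on either side of the front, as sets of points \<open>(x,t)\<close>.  They contain their part of the
  initial line \<open>t = 0\<close>, so that smoothness on them includes attaining the initial data continuously.
\<close>

definition left_region :: "ereal \<Rightarrow> (real \<Rightarrow> real) \<Rightarrow> (real \<times> real) set" where
  "left_region T s = {(x, t). t \<in> time_interval T \<and> x < s t}"

definition right_region :: "ereal \<Rightarrow> (real \<Rightarrow> real) \<Rightarrow> (real \<times> real) set" where
  "right_region T s = {(x, t). t \<in> time_interval T \<and> s t < x}"

text \<open>
  \<open>k\<close>-fold continuous differentiability, relative to \<open>S\<close>, through iterated directional derivatives.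
  For continuous \<open>s\<close> the regions above lie in the closure of their interior and the derivative
  \<open>h'\<close> is unique; at points with \<open>t > 0\<close> it is the ordinary derivative, at \<open>t = 0\<close> the one-sided one.
\<close>

fun times_cont_diff_on :: "nat \<Rightarrow> ('a::real_normed_vector \<Rightarrow> real) \<Rightarrow> 'a set \<Rightarrow> bool" where
  "times_cont_diff_on 0 h S \<longleftrightarrow> continuous_on S h"
| "times_cont_diff_on (Suc k) h S \<longleftrightarrow>
     (\<exists>h'. (\<forall>z\<in>S. (h has_derivative h' z) (at z within S)) \<and>
           (\<forall>v. times_cont_diff_on k (\<lambda>z. h' z v) S))"

definition smooth_on :: "('a::real_normed_vector \<Rightarrow> real) \<Rightarrow> 'a set \<Rightarrow> bool" where
  "smooth_on h S \<longleftrightarrow> (\<forall>k. times_cont_diff_on k h S)"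

text \<open>
  The equations \<open>\<rho>\<^sub>t + (\<rho> u)\<^sub>x = 0\<close> and \<open>u\<^sub>t + u u\<^sub>x = q(x,t,u)\<close> at the point \<open>(x,t)\<close>;
  at \<open>t = 0\<close> the time derivatives are one-sided.
\<close>

definition mass_equation_at ::
  "ereal \<Rightarrow> (real \<Rightarrow> real \<Rightarrow> real) \<Rightarrow> (real \<Rightarrow> real \<Rightarrow> real) \<Rightarrow> real \<Rightarrow> real \<Rightarrow> bool" where
  "mass_equation_at T rho u x t \<longleftrightarrow>
     (\<exists>rho_t flux_x.
        ((\<lambda>\<tau>. rho x \<tau>) has_real_derivative rho_t) (at t within time_interval T) \<and>
        ((\<lambda>y. rho y t * u y t) has_real_derivative flux_x) (at x) \<and>
        rho_t + flux_x = 0)"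

definition velocity_equation_at ::
  "ereal \<Rightarrow> (real \<Rightarrow> real \<Rightarrow> real \<Rightarrow> real) \<Rightarrow> (real \<Rightarrow> real \<Rightarrow> real) \<Rightarrow> real \<Rightarrow> real \<Rightarrow> bool" where
  "velocity_equation_at T q u x t \<longleftrightarrow>
     (\<exists>u_t u_x.
        ((\<lambda>\<tau>. u x \<tau>) has_real_derivative u_t) (at t within time_interval T) \<and>
        ((\<lambda>y. u y t) has_real_derivative u_x) (at x) \<and>
        u_t + u x t * u_x = q x t (u x t))"

definition left_trace :: "(real \<Rightarrow> real) \<Rightarrow> (real \<Rightarrow> real \<Rightarrow> real) \<Rightarrow> real \<Rightarrow> real" where
  "left_trace s h t = Lim (at_left (s t)) (\<lambda>x. h x t)"

definition right_trace :: "(real \<Rightarrow> real) \<Rightarrow> (real \<Rightarrow> real \<Rightarrow> real) \<Rightarrow> real \<Rightarrow> real" where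
  "right_trace s h t = Lim (at_right (s t)) (\<lambda>x. h x t)"

definition jump :: "(real \<Rightarrow> real) \<Rightarrow> (real \<Rightarrow> real \<Rightarrow> real) \<Rightarrow> real \<Rightarrow> real" where
  "jump s h t = right_trace s h t - left_trace s h t"

text \<open>\<open>Lim\<close> is unspecified when the limit does not exist, hence this existence condition.\<close>

definition has_traces :: "(real \<Rightarrow> real) \<Rightarrow> (real \<Rightarrow> real \<Rightarrow> real) \<Rightarrow> real \<Rightarrow> bool" where
  "has_traces s h t \<longleftrightarrow>
     (\<exists>l. ((\<lambda>x. h x t) \<longlongrightarrow> l) (at_left (s t))) \<and>
     (\<exists>r. ((\<lambda>x. h x t) \<longlongrightarrow> r) (at_right (s t)))"

text \<open>
  Delta shock solution on \<open>[0,T)\<close> of the Riemann problem with states \<open>(\<rho>\<^sub>-,u\<^sub>-) = (rl,ul)\<close> and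
  \<open>(\<rho>\<^sub>+,u\<^sub>+) = (rr,ur)\<close> for
  \<open>\<rho>\<^sub>t + (\<rho> u)\<^sub>x = 0\<close>, \<open>u\<^sub>t + (u^2/2)\<^sub>x = H(x - s(t)) f(x,t,u) + H(s(t) - x) g(x,t,u)\<close>,
  where the source is \<open>g\<close> to the left and \<open>f\<close> to the right of the front \<open>x = s(t)\<close>.

  On the front, \<open>rho (s t) t = w t\<close> is only the notational convention that the density carries a
  Dirac delta of weight \<open>w t\<close> there: it is not a pointwise density, and positivity of the density
  is required off the front only.
\<close>

definition delta_shock_solution ::
  "(real \<Rightarrow> real \<Rightarrow> real \<Rightarrow> real) \<Rightarrow> (real \<Rightarrow> real \<Rightarrow> real \<Rightarrow> real) \<Rightarrow>
   real \<Rightarrow> real \<Rightarrow> real \<Rightarrow> real \<Rightarrow> ereal \<Rightarrow>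
   (real \<Rightarrow> real) \<Rightarrow> (real \<Rightarrow> real) \<Rightarrow> (real \<Rightarrow> real) \<Rightarrow>
   (real \<Rightarrow> real \<Rightarrow> real) \<Rightarrow> (real \<Rightarrow> real \<Rightarrow> real) \<Rightarrow> bool" where
  "delta_shock_solution f g rl ul rr ur T s w u_delta rho u \<longleftrightarrow>
     0 < T \<and> s 0 = 0 \<and> w 0 = 0 \<and>
     (\<forall>t\<in>time_interval T. rho (s t) t = w t \<and> u (s t) t = u_delta t) \<and>
     (\<forall>t\<in>time_interval T. \<forall>x. x \<noteq> s t \<longrightarrow> 0 < rho x t) \<and>
     smooth_on (\<lambda>(x, t). rho x t) (left_region T s) \<and>
     smooth_on (\<lambda>(x, t). u x t) (left_region T s) \<and>
     smooth_on (\<lambda>(x, t). rho x t) (right_region T s) \<and>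
     smooth_on (\<lambda>(x, t). u x t) (right_region T s) \<and>
     (\<forall>(x, t)\<in>left_region T s. mass_equation_at T rho u x t \<and> velocity_equation_at T g u x t) \<and>
     (\<forall>(x, t)\<in>right_region T s. mass_equation_at T rho u x t \<and> velocity_equation_at T f u x t) \<and>
     (\<forall>x<0. rho x 0 = rl \<and> u x 0 = ul) \<and>
     (\<forall>x>0. rho x 0 = rr \<and> u x 0 = ur) \<and>
     (\<forall>t\<in>time_interval T.
        has_traces s rho t \<and> has_traces s u t \<and>
        (\<exists>\<sigma>. (s has_real_derivative \<sigma>) (at t within time_interval T) \<and>
             \<sigma> = u_delta t \<and>
             (w has_real_derivative (\<sigma> * jump s rho t - jump s (\<lambda>x t. rho x t * u x t) t))
               (at t within time_interval T) \<and>
             \<sigma> * jump s u t = jump s (\<lambda>x t. (u x t)\<^sup>2 / 2) t \<and>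
             right_trace s u t < \<sigma> \<and> \<sigma> < left_trace s u t))"

end

theory Submission
  imports Defs
begin

text \<open>
  Off the front each side carries a uniform state whose density is constant and whose velocity
  moves with the constant acceleration of the source there: \<open>1\<close> on the left, \<open>0\<close> on the right.
  Density and velocity do not depend on \<open>x\<close> on either side, so the transport terms vanish and the
  two balance laws reduce to \<open>\<rho>\<^sub>t = 0\<close> and \<open>u\<^sub>t = q\<close>; this is
  \<open>balance_laws_of_uniform_flow\<close>.  Density and velocity are also affine functions of the point
  \<open>(x,t)\<close>, hence smooth (\<open>smooth_on_affine\<close>).

  It remains to look at the front.  For the Burgers flux the condition
  \<open>\<sigma> [u] = [u\<^sup>2/2]\<close> forces \<open>\<sigma>\<close> to be the mean of the two traces
  \<open>u\<^sub>- + t\<close> and \<open>u\<^sub>+\<close>.  That mean is \<open>u_delta t\<close>, and \<open>s\<close> is its primitive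
  vanishing at \<open>0\<close>; the mean grows at rate \<open>1/2\<close>, which is why \<open>t\<^sup>2\<close> has coefficient \<open>1/4\<close> in
  \<open>s\<close>.  With this \<open>\<sigma>\<close> the mass deficit \<open>\<sigma> [\<rho>] - [\<rho> u]\<close> factors as
  \<open>(\<rho>\<^sub>- + \<rho>\<^sub>+)/2\<close> times the velocity drop \<open>u\<^sub>- + t - u\<^sub>+\<close>, and \<open>w\<close> is
  its primitive.  The entropy condition says that the mean lies strictly between the traces, that is
  \<open>u\<^sub>+ < u\<^sub>- + t\<close>; the source only widens the initial gap \<open>u\<^sub>- - u\<^sub>+ > 0\<close>, so
  it holds for all \<open>t \<ge> 0\<close>.
\<close>

text \<open>
  The derivative of an affine function is constant, so every directional derivative is again affine,
  with zero linear part.  Allowing an arbitrary linear part \<open>L\<close> is what makes the induction on the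
  order of differentiability go through.
\<close>

lemma times_cont_diff_on_affine:
  fixes h :: "'a::real_normed_vector \<Rightarrow> real"
  assumes "bounded_linear L" and "\<And>z. z \<in> S \<Longrightarrow> h z = c + L z"
  shows "times_cont_diff_on k h S"
  using assms
proof (induction k arbitrary: h c L)
  case 0
  have "continuous_on S (\<lambda>z. c + L z)"
    by (intro continuous_intros linear_continuous_on 0)
  then show ?case
    using 0 by (simp cong: continuous_on_cong)
next
  case (Suc k)
  have "(h has_derivative L) (at z within S)" if "z \<in> S" for z
  proof (rule has_derivative_transform[OF that])
    show "((\<lambda>z. c + L z) has_derivative L) (at z within S)"
      by (auto intro!: derivative_eq_intros bounded_linear_imp_has_derivative Suc.prems)
  qed (rule Suc.prems)
  moreover have "times_cont_diff_on k (\<lambda>z. L v) S" for v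
    by (rule Suc.IH[where L = "\<lambda>_. 0" and c = "L v"]) auto
  ultimately show ?case
    unfolding times_cont_diff_on.simps by (intro exI[of _ "\<lambda>_. L"]) blast
qed

lemma smooth_on_affine:
  fixes h :: "'a::real_normed_vector \<Rightarrow> real"
  assumes "bounded_linear L" and "\<And>z. z \<in> S \<Longrightarrow> h z = c + L z"
  shows "smooth_on h S"
  unfolding smooth_on_def using times_cont_diff_on_affine[OF assms] by blast

text \<open>
  The uniform state is only required near \<open>t\<close> on the vertical line and near \<open>x\<close> on the horizontal
  line, which is what a point strictly on one side of a moving front offers.
\<close>

lemma balance_laws_of_uniform_flow:
  assumes I: "open I" "t \<in> I" "\<And>\<tau>. \<tau> \<in> I \<Longrightarrow> rho x \<tau> = r \<and> u x \<tau> = c + a * \<tau>"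
    and J: "open J" "x \<in> J" "\<And>y. y \<in> J \<Longrightarrow> rho y t = r \<and> u y t = c + a * t"
    and q: "q x t (u x t) = a"
  shows "mass_equation_at T rho u x t" and "velocity_equation_at T q u x t"
proof -
  have rho_t: "((\<lambda>\<tau>. rho x \<tau>) has_real_derivative 0) (at t)"
    by (rule has_field_derivative_transform_within_open[of "\<lambda>_. r", OF _ I(1,2)])
      (simp_all add: I(3))
  have u_t: "((\<lambda>\<tau>. u x \<tau>) has_real_derivative a) (at t)"
    by (rule has_field_derivative_transform_within_open[of "\<lambda>\<tau>. c + a * \<tau>", OF _ I(1,2)])
      (auto simp: I(3) intro!: derivative_eq_intros)
  have flux_x: "((\<lambda>y. rho y t * u y t) has_real_derivative 0) (at x)"
    by (rule has_field_derivative_transform_within_open[of "\<lambda>_. r * (c + a * t)", OF _ J(1,2)])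
      (simp_all add: J(3))
  have u_x: "((\<lambda>y. u y t) has_real_derivative 0) (at x)"
    by (rule has_field_derivative_transform_within_open[of "\<lambda>_. c + a * t", OF _ J(1,2)])
      (simp_all add: J(3))
  show "mass_equation_at T rho u x t"
    unfolding mass_equation_at_def
    using has_field_derivative_at_within[OF rho_t] flux_x by force
  show "velocity_equation_at T q u x t"
    unfolding velocity_equation_at_def
    using has_field_derivative_at_within[OF u_t] u_x q by force
qed

lemma tendsto_at_left_of_const:
  fixes h :: "real \<Rightarrow> real \<Rightarrow> real"
  assumes "\<And>x. x < s t \<Longrightarrow> h x t = c"
  shows "((\<lambda>x. h x t) \<longlongrightarrow> c) (at_left (s t))"
  by (rule tendsto_eventually) (auto simp: eventually_at_filter assms)

lemma tendsto_at_right_of_const: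
  fixes h :: "real \<Rightarrow> real \<Rightarrow> real"
  assumes "\<And>x. s t < x \<Longrightarrow> h x t = c"
  shows "((\<lambda>x. h x t) \<longlongrightarrow> c) (at_right (s t))"
  by (rule tendsto_eventually) (auto simp: eventually_at_filter assms)

lemma left_trace_of_const:
  assumes "\<And>x. x < s t \<Longrightarrow> h x t = c"
  shows "left_trace s h t = c"
  unfolding left_trace_def
  by (rule tendsto_Lim[OF _ tendsto_at_left_of_const]) (simp_all add: assms)

lemma right_trace_of_const:
  assumes "\<And>x. s t < x \<Longrightarrow> h x t = c"
  shows "right_trace s h t = c"
  unfolding right_trace_def
  by (rule tendsto_Lim[OF _ tendsto_at_right_of_const]) (simp_all add: assms)

lemma jump_of_const:
  assumes "\<And>x. x < s t \<Longrightarrow> h x t = l" and "\<And>x. s t < x \<Longrightarrow> h x t = r"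
  shows "jump s h t = r - l"
  unfolding jump_def using left_trace_of_const[of s t h l] right_trace_of_const[of s t h r] assms
  by simp

lemma has_traces_of_const:
  assumes "\<And>x. x < s t \<Longrightarrow> h x t = l" and "\<And>x. s t < x \<Longrightarrow> h x t = r"
  shows "has_traces s h t"
  unfolding has_traces_def
  using tendsto_at_left_of_const[of s t h l] tendsto_at_right_of_const[of s t h r] assms by blast

theorem theorem3p1:
  fixes rho_minus rho_plus u_minus u_plus :: real
    and s w u_delta :: "real \<Rightarrow> real"
    and rho u :: "real \<Rightarrow> real \<Rightarrow> real"
  assumes "rho_minus > 0" and "rho_plus > 0" and "u_minus > u_plus"
    and "\<And>t. s t = 1/4 * t\<^sup>2 + 1/2 * (u_minus + u_plus) * t"
    and "\<And>t. w t = 1/2 * (rho_minus + rho_plus) * (1/2 * t\<^sup>2 + (u_minus - u_plus) * t)"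
    and "\<And>t. u_delta t = 1/2 * (u_minus + u_plus + t)"
    and "\<And>x t. (rho x t, u x t) =
           (if x < s t then (rho_minus, u_minus + t)
            else if x = s t then (w t, u_delta t)
            else (rho_plus, u_plus))"
  shows "delta_shock_solution (\<lambda>x t v. 0) (\<lambda>x t v. 1)
           rho_minus u_minus rho_plus u_plus \<infinity> s w u_delta rho u"
proof -
  have left: "rho x t = rho_minus" "u x t = u_minus + t" if "x < s t" for x t
    using assms(7)[of x t] that by auto
  have right: "rho x t = rho_plus" "u x t = u_plus" if "s t < x" for x t
    using assms(7)[of x t] that by auto
  have front: "rho (s t) t = w t" "u (s t) t = u_delta t" for t
    using assms(7)[of "s t" t] by auto
  have s_eq: "s = (\<lambda>t. 1/4 * t\<^sup>2 + 1/2 * (u_minus + u_plus) * t)"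
    and w_eq: "w = (\<lambda>t. 1/2 * (rho_minus + rho_plus) * (1/2 * t\<^sup>2 + (u_minus - u_plus) * t))"
    using assms(4,5) by blast+
  have s_cont: "continuous_on UNIV s"
    unfolding s_eq by (intro continuous_intros)
  have zero: "s 0 = 0" "w 0 = 0"
    by (simp_all add: s_eq w_eq)

  have smooth:
    "smooth_on (\<lambda>(x, t). rho x t) (left_region \<infinity> s)"
    "smooth_on (\<lambda>(x, t). u x t) (left_region \<infinity> s)"
    "smooth_on (\<lambda>(x, t). rho x t) (right_region \<infinity> s)"
    "smooth_on (\<lambda>(x, t). u x t) (right_region \<infinity> s)"
    by (rule smooth_on_affine[where L = "\<lambda>_. 0" and c = rho_minus]
        smooth_on_affine[where L = snd and c = u_minus]
        smooth_on_affine[where L = "\<lambda>_. 0" and c = rho_plus]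
        smooth_on_affine[where L = "\<lambda>_. 0" and c = u_plus],
        auto simp: left_region_def right_region_def left right bounded_linear_snd)+

  have left_laws: "mass_equation_at \<infinity> rho u x t" "velocity_equation_at \<infinity> (\<lambda>x t v. 1) u x t"
    if "x < s t" for x t
  proof -
    have "open {\<tau>. x < s \<tau>}"
      by (intro open_Collect_less continuous_intros s_cont)
    note laws = balance_laws_of_uniform_flow[OF this, where J = "{..<s t}" and a = 1
        and r = rho_minus and c = u_minus]
    show "mass_equation_at \<infinity> rho u x t" "velocity_equation_at \<infinity> (\<lambda>x t v. 1) u x t"
      by (rule laws[where q = "\<lambda>x t v. 1"]; use that in \<open>simp add: left\<close>)+
  qed
  have right_laws: "mass_equation_at \<infinity> rho u x t" "velocity_equation_at \<infinity> (\<lambda>x t v. 0) u x t"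
    if "s t < x" for x t
  proof -
    have "open {\<tau>. s \<tau> < x}"
      by (intro open_Collect_less continuous_intros s_cont)
    note laws = balance_laws_of_uniform_flow[OF this, where J = "{s t<..}" and a = 0
        and r = rho_plus and c = u_plus]
    show "mass_equation_at \<infinity> rho u x t" "velocity_equation_at \<infinity> (\<lambda>x t v. 0) u x t"
      by (rule laws[where q = "\<lambda>x t v. 0"]; use that in \<open>simp add: right\<close>)+
  qed

  have jumps:
    "jump s rho t = rho_plus - rho_minus"
    "jump s u t = u_plus - (u_minus + t)"
    "jump s (\<lambda>x t. rho x t * u x t) t = rho_plus * u_plus - rho_minus * (u_minus + t)"
    "jump s (\<lambda>x t. (u x t)\<^sup>2 / 2) t = u_plus\<^sup>2 / 2 - (u_minus + t)\<^sup>2 / 2"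
    "left_trace s u t = u_minus + t" "right_trace s u t = u_plus" for t
    by (rule jump_of_const left_trace_of_const right_trace_of_const; simp add: left right)+
  have traces: "has_traces s rho t" "has_traces s u t" for t
    by (rule has_traces_of_const[of s t, OF left(1) right(1)]
        has_traces_of_const[of s t, OF left(2) right(2)]; assumption)+

  have s_deriv: "(s has_real_derivative u_delta t) (at t within A)" for t A
    unfolding s_eq assms(6)
    by (auto intro!: derivative_eq_intros simp: field_simps)
  have w_deriv: "(w has_real_derivative
      (u_delta t * jump s rho t - jump s (\<lambda>x t. rho x t * u x t) t)) (at t within A)" for t A
  proof -
    have "u_delta t * jump s rho t - jump s (\<lambda>x t. rho x t * u x t) t
        = 1/2 * (rho_minus + rho_plus) * (t + (u_minus - u_plus))"
      unfolding jumps assms(6) by (simp add: field_simps)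
    moreover have "(w has_real_derivative 1/2 * (rho_minus + rho_plus) * (t + (u_minus - u_plus)))
        (at t within A)"
      unfolding w_eq by (auto intro!: derivative_eq_intros simp: field_simps)
    ultimately show ?thesis by (simp only:)
  qed
  have mean: "u_delta t * jump s u t = jump s (\<lambda>x t. (u x t)\<^sup>2 / 2) t" for t
    unfolding jumps assms(6) by (simp add: power2_eq_square field_simps)
  have entropy: "right_trace s u t < u_delta t" "u_delta t < left_trace s u t" if "0 \<le> t" for t
    unfolding jumps assms(6) using that assms(3) by simp_all

  have pos: "0 < rho x t" if "x \<noteq> s t" for x t
    using that left(1)[of x t] right(1)[of t x] assms(1,2) by (cases "x < s t") auto
  have init: "\<forall>x<0. rho x 0 = rho_minus \<and> u x 0 = u_minus"
    "\<forall>x>0. rho x 0 = rho_plus \<and> u x 0 = u_plus"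
    using left[of _ 0] right[of 0] by (simp_all add: zero)
  have front_conditions: "\<forall>t\<in>time_interval \<infinity>.
        has_traces s rho t \<and> has_traces s u t \<and>
        (\<exists>\<sigma>. (s has_real_derivative \<sigma>) (at t within time_interval \<infinity>) \<and>
             \<sigma> = u_delta t \<and>
             (w has_real_derivative (\<sigma> * jump s rho t - jump s (\<lambda>x t. rho x t * u x t) t))
               (at t within time_interval \<infinity>) \<and>
             \<sigma> * jump s u t = jump s (\<lambda>x t. (u x t)\<^sup>2 / 2) t \<and>
             right_trace s u t < \<sigma> \<and> \<sigma> < left_trace s u t)"
    using traces s_deriv w_deriv mean entropy by (auto simp: time_interval_def)
  show ?thesis
    unfolding delta_shock_solution_def
    using zero front pos smooth init front_conditions left_laws right_laws
    by (auto simp: left_region_def right_region_def)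
qed

end
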